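(* Let $G$ be a locally compact topological group and let $H\subset G$ be a subsemigroup which is meager in $G$ and quasi-analytic. Then $H$ belongs to the $\sigma$-ideal $\mathcal E_G$ generated by the closed subsets of $G$ of Haar measure zero, and hence $H$ can be covered by countably many closed sets of Haar measure zero.
   Context: A topological space is Baire if every countable intersection of open dense subsets is dense; hereditarily Baire if each closed subspace is Baire; quasi-analytic if it is a continuous image of a hereditarily Baire metrizable separable space. The subsemigroup $H$ carries the subspace topology. A $\sigma$-ideal on $G$ is a non-empty family of subsets of $G$ closed under taking subsets and countable unions; $\mathcal E_G$ consists of all subsets of countable unions of closed sets of Haar measure zero in $G$. *)

theory Defs
  imports "HOL-Analysis.Analysis"
begin

subsection \<open>Baire category\<close>

definition nowhere_dense_in :: "'a topology \<Rightarrow> 'a set \<Rightarrow> bool" where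
  "nowhere_dense_in X A \<longleftrightarrow> A \<subseteq> topspace X \<and> X interior_of (X closure_of A) = {}"

definition meager_in :: "'a topology \<Rightarrow> 'a set \<Rightarrow> bool" where
  "meager_in X A \<longleftrightarrow> (\<exists>\<N>. countable \<N> \<and> (\<forall>N\<in>\<N>. nowhere_dense_in X N) \<and> A = \<Union>\<N>)"

definition Baire_space :: "'a topology \<Rightarrow> bool" where
  "Baire_space X \<longleftrightarrow>
     (\<forall>\<U>. countable \<U> \<and> (\<forall>U\<in>\<U>. openin X U \<and> X closure_of U = topspace X)
        \<longrightarrow> X closure_of (topspace X \<inter> \<Inter>\<U>) = topspace X)"

definition hereditarily_Baire_space :: "'a topology \<Rightarrow> bool" where
  "hereditarily_Baire_space X \<longleftrightarrow> (\<forall>C. closedin X C \<longrightarrow> Baire_space (subtopology X C))"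

text \<open>A definition cannot quantify over types, so the parametrizing space lives on a fixed type.
  The type of sets of naturals has the cardinality of the continuum, hence carries a homeomorphic
  copy of every separable metrizable space; the lemma \<open>quasi_analytic_spaceI\<close> below shows that
  no generality is lost.\<close>

definition quasi_analytic_space :: "'a topology \<Rightarrow> bool" where
  "quasi_analytic_space Y \<longleftrightarrow>
     (\<exists>(X :: nat set topology) f.
        hereditarily_Baire_space X \<and> metrizable_space X \<and> separable_space X \<and>
        continuous_map X Y f \<and> f ` topspace X = topspace Y)"

lemma Baire_space_homeomorphic:
  assumes h: "homeomorphic_map X Y h" and B: "Baire_space X"
  shows "Baire_space Y"
  unfolding Baire_space_def
proof (intro allI impI, elim conjE)
  fix \<U> assume c: "countable \<U>" and U: "\<forall>U\<in>\<U>. openin Y U \<and> Y closure_of U = topspace Y"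
  obtain g where hg: "homeomorphic_maps X Y h g"
    using h homeomorphic_map_maps by blast
  have g: "homeomorphic_map Y X g"
    using hg homeomorphic_maps_map by blast
  have gh: "\<And>y. y \<in> topspace Y \<Longrightarrow> h (g y) = y"
    using hg by (auto simp: homeomorphic_maps_def)
  have im: "g ` topspace Y = topspace X"
    using g by (rule homeomorphic_imp_surjective_map)
  let ?V = "(`) g ` \<U>"
  have Us: "\<And>U. U \<in> \<U> \<Longrightarrow> U \<subseteq> topspace Y"
    using U openin_subset by blast
  have "X closure_of (topspace X \<inter> \<Inter>?V) = topspace X"
  proof -
    have "openin X (g ` U) \<and> X closure_of (g ` U) = topspace X" if "U \<in> \<U>" for U
    proof -
      have U': "openin Y U" "Y closure_of U = topspace Y" using U that by auto
      show ?thesis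
        using U'(1) homeomorphic_map_openness_eq[OF g, of U]
          homeomorphic_map_closure_of[OF g Us[OF that]] U'(2) im by simp
    qed
    then have "countable ?V \<and> (\<forall>V\<in>?V. openin X V \<and> X closure_of V = topspace X)"
      using c by simp
    then show ?thesis
      using B[unfolded Baire_space_def, rule_format, of ?V] by simp
  qed
  moreover have "topspace X \<inter> \<Inter>?V = g ` (topspace Y \<inter> \<Inter>\<U>)"
  proof -
    have inj: "inj_on g (topspace Y)"
      using gh by (metis inj_onI)
    show ?thesis
    proof (intro equalityI subsetI)
      fix x assume x: "x \<in> topspace X \<inter> \<Inter>?V"
      then obtain y where y: "y \<in> topspace Y" "x = g y" using im by blast
      have "y \<in> U" if "U \<in> \<U>" for U
      proof -
        have "g y \<in> g ` U" using x y that by blast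
        then show ?thesis using inj Us[OF that] y(1) by (meson inj_on_image_mem_iff)
      qed
      then show "x \<in> g ` (topspace Y \<inter> \<Inter>\<U>)" using y by blast
    next
      fix x assume "x \<in> g ` (topspace Y \<inter> \<Inter>\<U>)"
      then show "x \<in> topspace X \<inter> \<Inter>?V" using im by blast
    qed
  qed
  ultimately have 1: "g ` (Y closure_of (topspace Y \<inter> \<Inter>\<U>)) = g ` topspace Y"
    using homeomorphic_map_closure_of[OF g, of "topspace Y \<inter> \<Inter>\<U>"] im by simp
  have "inj_on g (topspace Y)" using gh by (metis inj_onI)
  from inj_on_image_eq_iff[OF this closure_of_subset_topspace subset_refl] 1
  show "Y closure_of (topspace Y \<inter> \<Inter>\<U>) = topspace Y" by blast
qed

lemma hereditarily_Baire_space_homeomorphic: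
  assumes h: "homeomorphic_map X Y h" and B: "hereditarily_Baire_space X"
  shows "hereditarily_Baire_space Y"
  unfolding hereditarily_Baire_space_def
proof (intro allI impI)
  fix C assume C: "closedin Y C"
  obtain g where hg: "homeomorphic_maps X Y h g"
    using h homeomorphic_map_maps by blast
  have g: "homeomorphic_map Y X g"
    using hg homeomorphic_maps_map by blast
  have gh: "\<And>y. y \<in> topspace Y \<Longrightarrow> h (g y) = y"
    using hg by (auto simp: homeomorphic_maps_def)
  have sub: "C \<subseteq> topspace Y" using C closedin_subset by blast
  have gC: "closedin X (g ` C)"
    using C sub homeomorphic_map_closedness_eq[OF g] by blast
  then have "Baire_space (subtopology X (g ` C))"
    using B hereditarily_Baire_space_def by blast
  moreover have "h ` (g ` C) = C"
    using gh sub by force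
  then have "homeomorphic_map (subtopology X (g ` C)) (subtopology Y C) h"
    using h closedin_subset[OF gC] sub
    by (metis homeomorphic_map_subtopologies homeomorphic_imp_surjective_map inf.absorb2 inf.absorb_iff2)
  ultimately show "Baire_space (subtopology Y C)"
    using Baire_space_homeomorphic by blast
qed

lemma separable_metrizable_inj_nat_set:
  fixes X :: "'b topology"
  assumes "metrizable_space X" "separable_space X"
  obtains e :: "'b \<Rightarrow> nat set" where "inj_on e (topspace X)"
proof -
  obtain M d where "Metric_space M d" and X: "X = Metric_space.mtopology M d"
    using assms(1) unfolding metrizable_space_def by blast
  interpret Metric_space M d by fact
  obtain D where D: "countable D" "D \<subseteq> topspace X" "X closure_of D = topspace X"
    using assms(2) unfolding separable_space_def by blast
  define e where "e x = {n. d (from_nat_into D (fst (prod_decode n))) x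
                          < inverse (real (Suc (snd (prod_decode n))))}" for x
  have "inj_on e M"
  proof (rule inj_onI, rule ccontr)
    fix x y assume xy: "x \<in> M" "y \<in> M" "e x = e y" "x \<noteq> y"
    then have "d x y > 0" by simp
    then obtain k where k: "inverse (real (Suc k)) < d x y / 2"
      using reals_Archimedean[of "d x y / 2"] by auto
    have "x \<in> mtopology closure_of D" using D X xy by simp
    then have "\<forall>r>0. \<exists>z\<in>D. z \<in> mball x r"
      unfolding metric_closure_of by simp
    moreover have "0 < inverse (real (Suc k))" by simp
    ultimately obtain z where z: "z \<in> D" "z \<in> mball x (inverse (real (Suc k)))"
      by meson
    then obtain i where i: "from_nat_into D i = z"
      using D(1) by (metis from_nat_into_surj)
    have zM: "z \<in> M" using z by auto
    have "prod_encode (i, k) \<in> e x" using z i commute by (auto simp: e_def)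
    then have "prod_encode (i, k) \<in> e y" using xy by simp
    then have "d z y < inverse (real (Suc k))" using i by (simp add: e_def)
    moreover have "d x z < inverse (real (Suc k))" using z by simp
    moreover have "d x y \<le> d x z + d z y" using triangle xy zM by blast
    ultimately show False using k by linarith
  qed
  then show ?thesis using that X by simp
qed

lemma quasi_analytic_spaceI:
  fixes X :: "'b topology"
  assumes "hereditarily_Baire_space X" "metrizable_space X" "separable_space X"
    and f: "continuous_map X Y f" "f ` topspace X = topspace Y"
  shows "quasi_analytic_space Y"
proof -
  obtain e :: "'b \<Rightarrow> nat set" where e: "inj_on e (topspace X)"
    using separable_metrizable_inj_nat_set assms by blast
  define g where "g = inv_into (topspace X) e"
  define Z where "Z = pullback_topology (e ` topspace X) g X"
  have ge: "\<And>x. x \<in> topspace X \<Longrightarrow> g (e x) = x"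
    using e by (simp add: g_def)
  have Z: "topspace Z = e ` topspace X"
    unfolding Z_def topspace_pullback_topology using ge by auto
  have "continuous_map Z X g"
    unfolding Z_def using continuous_map_pullback[OF continuous_map_id, of "e ` topspace X" g X]
    by simp
  moreover have "continuous_map X Z e"
    unfolding Z_def
  proof (rule continuous_map_pullback')
    show "continuous_map X X (g \<circ> e)"
      using ge by (metis comp_apply continuous_map_eq continuous_map_id id_apply)
  qed auto
  ultimately have maps: "homeomorphic_maps X Z e g"
    using ge Z by (auto simp: homeomorphic_maps_def)
  then have hom: "homeomorphic_map X Z e"
    using homeomorphic_map_maps by blast
  have hs: "X homeomorphic_space Z"
    using maps homeomorphic_space_def by blast
  show ?thesis
    unfolding quasi_analytic_space_def
  proof (intro exI conjI)
    show "hereditarily_Baire_space Z"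
      using hereditarily_Baire_space_homeomorphic[OF hom] assms(1) .
    show "metrizable_space Z"
      using homeomorphic_metrizable_space[OF hs] assms(2) by simp
    show "separable_space Z"
      using homeomorphic_separable_space[OF hs] assms(3) by simp
    show "continuous_map Z Y (f \<circ> g)"
      using \<open>continuous_map Z X g\<close> f(1) by (rule continuous_map_compose)
    show "(f \<circ> g) ` topspace Z = topspace Y"
      using Z ge f(2) by (auto simp: image_comp)
  qed
qed


subsection \<open>Haar measure\<close>

text \<open>The group is written additively, because that is the notation of the library class of
  topological groups; it need not be commutative. A Haar measure is a nonzero left-invariant Radon
  measure on the Borel sets: finite on compact sets, outer regular on Borel sets and inner regular
  on open sets.\<close>

definition Haar_measure :: "'a::{topological_group_add, t2_space} measure \<Rightarrow> bool" where
  "Haar_measure \<mu> \<longleftrightarrow>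
     sets \<mu> = sets borel \<and>
     emeasure \<mu> UNIV \<noteq> 0 \<and>
     (\<forall>a. \<forall>B\<in>sets borel. emeasure \<mu> ((\<lambda>x. a + x) ` B) = emeasure \<mu> B) \<and>
     (\<forall>K. compact K \<longrightarrow> emeasure \<mu> K < \<infinity>) \<and>
     (\<forall>B\<in>sets borel. emeasure \<mu> B = (INF U\<in>{U. open U \<and> B \<subseteq> U}. emeasure \<mu> U)) \<and>
     (\<forall>U. open U \<longrightarrow> emeasure \<mu> U = (SUP K\<in>{K. compact K \<and> K \<subseteq> U}. emeasure \<mu> K))"


subsection \<open>The \<open>\<sigma>\<close>-ideal generated by the closed null sets\<close>

definition sigma_ideal :: "'a set set \<Rightarrow> bool" where
  "sigma_ideal \<I> \<longleftrightarrow>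
     \<I> \<noteq> {} \<and>
     (\<forall>A\<in>\<I>. \<forall>B. B \<subseteq> A \<longrightarrow> B \<in> \<I>) \<and>
     (\<forall>\<A>. countable \<A> \<and> \<A> \<subseteq> \<I> \<longrightarrow> \<Union>\<A> \<in> \<I>)"

definition closed_null_ideal :: "'a::topological_space measure \<Rightarrow> 'a set set" where
  "closed_null_ideal \<mu> =
     {A. \<exists>\<F>. countable \<F> \<and> (\<forall>F\<in>\<F>. closed F \<and> emeasure \<mu> F = 0) \<and> A \<subseteq> \<Union>\<F>}"

lemma sigma_ideal_closed_null_ideal: "sigma_ideal (closed_null_ideal \<mu>)"
  unfolding sigma_ideal_def
proof (intro conjI ballI allI impI)
  have "{} \<in> closed_null_ideal \<mu>"
    unfolding closed_null_ideal_def by (intro CollectI exI[of _ "{}"]) simp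
  then show "closed_null_ideal \<mu> \<noteq> {}" by blast
next
  fix A B assume "A \<in> closed_null_ideal \<mu>" and BA: "B \<subseteq> A"
  then obtain \<F> where "countable \<F>" "\<forall>F\<in>\<F>. closed F \<and> emeasure \<mu> F = 0" "A \<subseteq> \<Union>\<F>"
    unfolding closed_null_ideal_def by blast
  moreover have "B \<subseteq> \<Union>\<F>" using BA \<open>A \<subseteq> \<Union>\<F>\<close> by (rule order_trans)
  ultimately show "B \<in> closed_null_ideal \<mu>"
    unfolding closed_null_ideal_def by blast
next
  fix \<A> assume *: "countable \<A> \<and> \<A> \<subseteq> closed_null_ideal \<mu>"
  have c: "countable \<A>" using * by blast
  have "\<exists>\<F>. countable \<F> \<and> (\<forall>F\<in>\<F>. closed F \<and> emeasure \<mu> F = 0) \<and> A \<subseteq> \<Union>\<F>"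
    if "A \<in> \<A>" for A
  proof -
    have "A \<in> closed_null_ideal \<mu>" using * that by blast
    then show ?thesis by (simp add: closed_null_ideal_def)
  qed
  then obtain \<F> where
    F: "\<And>A. A \<in> \<A> \<Longrightarrow> countable (\<F> A) \<and> (\<forall>F\<in>\<F> A. closed F \<and> emeasure \<mu> F = 0) \<and> A \<subseteq> \<Union>(\<F> A)"
    by metis
  have "countable (\<Union>(\<F> ` \<A>))" using c F by simp
  moreover have "\<forall>F\<in>\<Union>(\<F> ` \<A>). closed F \<and> emeasure \<mu> F = 0" using F by simp
  moreover have "\<Union>\<A> \<subseteq> \<Union>(\<Union>(\<F> ` \<A>))"
  proof
    fix x assume "x \<in> \<Union>\<A>"
    then obtain A where A: "A \<in> \<A>" "x \<in> A" by blast
    then have "x \<in> \<Union>(\<F> A)" using F[OF A(1)] by (meson subsetD)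
    then show "x \<in> \<Union>(\<Union>(\<F> ` \<A>))" using A(1) by blast
  qed
  ultimately show "\<Union>\<A> \<in> closed_null_ideal \<mu>"
    unfolding closed_null_ideal_def by (intro CollectI exI[of _ "\<Union>(\<F> ` \<A>)"] conjI)
qed

lemma closed_null_ideal_least:
  assumes "sigma_ideal \<I>" "\<And>F. closed F \<Longrightarrow> emeasure \<mu> F = 0 \<Longrightarrow> F \<in> \<I>"
  shows "closed_null_ideal \<mu> \<subseteq> \<I>"
proof
  fix A assume "A \<in> closed_null_ideal \<mu>"
  then obtain \<F> where F: "countable \<F>" "\<forall>F\<in>\<F>. closed F \<and> emeasure \<mu> F = 0" "A \<subseteq> \<Union>\<F>"
    unfolding closed_null_ideal_def by blast
  then have "\<F> \<subseteq> \<I>" using assms(2) by blast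
  then have "\<Union>\<F> \<in> \<I>" using F(1) assms(1) unfolding sigma_ideal_def by simp
  then show "A \<in> \<I>" using F(3) assms(1) unfolding sigma_ideal_def by simp
qed

end

theory Submission
  imports Defs
begin

text \<open>
  Suppose that \<open>H\<close> is not in the ideal \<open>\<E>\<close> generated by the closed null sets, and let
  \<open>f\<close> map a hereditarily Baire, separable metrizable space \<open>X\<close> continuously onto \<open>H\<close>.
  Removing from \<open>X\<close> all open sets with image in \<open>\<E>\<close> leaves a nonempty closed set \<open>C\<close>, again a
  Baire space, such that the image of every nonempty relatively open subset of \<open>C\<close> is outside
  \<open>\<E>\<close>; in particular the closure of such an image is not null (\<open>sigma_ideal_kernel\<close>).

  As a semigroup, \<open>H\<close> contains \<open>f x + f y\<close> for all \<open>x\<close>, \<open>y\<close> in \<open>C\<close>, and \<open>H\<close> is covered by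
  countably many closed nowhere dense sets. Hence the square of \<open>C\<close> is covered by the countably
  many closed sets \<open>{(x, y). f x + f y \<in> closure N}\<close>, and a category argument finds an open
  rectangle \<open>U \<times> V\<close> inside one of them (\<open>Baire_space_rectangle\<close>). Passing to closures gives
  two non-null closed sets whose sum lies in a nowhere dense closed set. Local compactness
  allows both to be taken compact, and this contradicts the theorem of Steinhaus that the sum of
  two compact sets of positive Haar measure has an interior point (\<open>Steinhaus_sum\<close>).

  The usual proof of Steinhaus' theorem integrates \<open>\<mu> (A \<inter> (w - B))\<close> over \<open>w\<close> by Fubini's
  theorem. Without a countable base the group operations need not be measurable for the product
  of the Borel \<open>\<sigma>\<close>-algebras, so this integral is replaced by a finite sum over a fine
  partition of \<open>A + B\<close> (\<open>exists_positive_overlap\<close>).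
\<close>

section \<open>Baire category\<close>

lemma separable_metrizable_imp_second_countable:
  assumes "metrizable_space X" "separable_space X"
  shows "second_countable X"
proof -
  obtain M d where "Metric_space M d" and X: "X = Metric_space.mtopology M d"
    using assms(1) unfolding metrizable_space_def by blast
  interpret Metric_space M d by fact
  obtain D where D: "countable D" "D \<subseteq> topspace X" "X closure_of D = topspace X"
    using assms(2) unfolding separable_space_def by blast
  define \<B> where "\<B> = (\<lambda>(z, n). mball z (inverse (Suc n))) ` (D \<times> (UNIV :: nat set))"
  show ?thesis
    unfolding second_countable_def
  proof (intro exI[of _ \<B>] conjI ballI allI impI)
    show "countable \<B>" using D(1) by (simp add: \<B>_def)
    show "openin X V" if "V \<in> \<B>" for V using that by (auto simp: \<B>_def X)
  next
    fix U x assume *: "openin X U \<and> x \<in> U"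
    then obtain r where r: "r > 0" "mball x r \<subseteq> U"
      unfolding X openin_mtopology by blast
    have x: "x \<in> M" using * openin_subset X by fastforce
    obtain n where n: "inverse (real (Suc n)) < r / 2"
      using reals_Archimedean[of "r / 2"] r by auto
    have "x \<in> mtopology closure_of D" using D X x by simp
    then have "\<forall>r>0. \<exists>z\<in>D. z \<in> mball x r"
      unfolding metric_closure_of by simp
    moreover have "0 < inverse (real (Suc n))" by simp
    ultimately obtain z where z: "z \<in> D" "z \<in> mball x (inverse (real (Suc n)))"
      by meson
    have "mball z (inverse (Suc n)) \<subseteq> mball x r"
    proof
      fix y assume y: "y \<in> mball z (inverse (Suc n))"
      have "d x y \<le> d x z + d z y" using triangle x y z by simp
      moreover have "d x z < r / 2" "d z y < r / 2" using z y n by simp_all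
      ultimately show "y \<in> mball x r" using x y by simp
    qed
    moreover have "x \<in> mball z (inverse (Suc n))" using z x commute by simp
    moreover have "mball z (inverse (Suc n)) \<in> \<B>" using z by (auto simp: \<B>_def)
    ultimately show "\<exists>V\<in>\<B>. x \<in> V \<and> V \<subseteq> U" using r by blast
  qed
qed

text \<open>
  The Baire property in terms of closed sets: if every \<open>C i\<close> had empty interior, the
  complements would be dense open sets with empty intersection.
\<close>

lemma Baire_space_countable_closed_cover:
  assumes B: "Baire_space X" and ne: "topspace X \<noteq> {}"
    and c: "countable I" and cl: "\<And>i. i \<in> I \<Longrightarrow> closedin X (C i)"
    and cov: "topspace X \<subseteq> (\<Union>i\<in>I. C i)"
  obtains i U where "i \<in> I" "openin X U" "U \<noteq> {}" "U \<subseteq> C i"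
proof -
  have "\<exists>i\<in>I. X interior_of (C i) \<noteq> {}"
  proof (rule ccontr)
    assume *: "\<not> ?thesis"
    let ?\<U> = "(\<lambda>i. topspace X - C i) ` I"
    have "X closure_of (topspace X - C i) = topspace X" if "i \<in> I" for i
      using * that by (simp add: closure_of_complement)
    then have "countable ?\<U> \<and> (\<forall>U\<in>?\<U>. openin X U \<and> X closure_of U = topspace X)"
      using c cl by auto
    then have "X closure_of (topspace X \<inter> \<Inter>?\<U>) = topspace X"
      using B unfolding Baire_space_def by blast
    moreover have "topspace X \<inter> \<Inter>?\<U> = {}" using cov by auto
    ultimately show False using ne by (metis closure_of_empty)
  qed
  then obtain i where "i \<in> I" "X interior_of (C i) \<noteq> {}" by blast
  then show ?thesis
    by (rule that[OF _ openin_interior_of _ interior_of_subset])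
qed

text \<open>
  A product of two Baire spaces, one of them second countable, is Baire in this form, and it
  suffices that the relations are closed in each variable separately. For fixed \<open>x\<close> the
  sections cover \<open>Y\<close>, so one of them contains a member of the countable base of \<open>Y\<close>; the
  points \<open>x\<close> that share the relation and the basic set form a closed set, and countably many
  of these closed sets cover \<open>X\<close>.
\<close>

lemma Baire_space_rectangle:
  assumes X: "Baire_space X" "topspace X \<noteq> {}"
    and Y: "Baire_space Y" "topspace Y \<noteq> {}" "second_countable Y"
    and c: "countable I"
    and clY: "\<And>i x. i \<in> I \<Longrightarrow> x \<in> topspace X \<Longrightarrow> closedin Y {y \<in> topspace Y. R i x y}"
    and clX: "\<And>i y. i \<in> I \<Longrightarrow> y \<in> topspace Y \<Longrightarrow> closedin X {x \<in> topspace X. R i x y}"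
    and cov: "\<And>x y. x \<in> topspace X \<Longrightarrow> y \<in> topspace Y \<Longrightarrow> \<exists>i\<in>I. R i x y"
  obtains i U V where "i \<in> I" "openin X U" "U \<noteq> {}" "openin Y V" "V \<noteq> {}"
    "\<And>x y. x \<in> U \<Longrightarrow> y \<in> V \<Longrightarrow> R i x y"
proof -
  obtain \<B> where \<B>: "countable \<B>" "\<forall>V\<in>\<B>. openin Y V"
    "\<forall>U x. openin Y U \<and> x \<in> U \<longrightarrow> (\<exists>V\<in>\<B>. x \<in> V \<and> V \<subseteq> U)"
    using Y(3) unfolding second_countable_def by (elim exE conjE)
  define J where "J = I \<times> {V \<in> \<B>. V \<noteq> {}}"
  define C where "C = (\<lambda>(i, V). {x \<in> topspace X. \<forall>y\<in>V. R i x y})"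
  have "countable J" using c \<B>(1) by (simp add: J_def)
  moreover have "closedin X (C j)" if J: "j \<in> J" for j
  proof -
    obtain i V where j: "j = (i, V)" "i \<in> I" "V \<in> \<B>" "V \<noteq> {}" using J by (auto simp: J_def)
    have "C j = (\<Inter>y\<in>V. {x \<in> topspace X. R i x y})" using j by (auto simp: C_def)
    moreover have "V \<subseteq> topspace Y" using \<B>(2) j openin_subset by blast
    ultimately show ?thesis using j clX by (auto intro!: closedin_Inter)
  qed
  moreover have "topspace X \<subseteq> (\<Union>j\<in>J. C j)"
  proof
    fix x assume x: "x \<in> topspace X"
    have "topspace Y \<subseteq> (\<Union>i\<in>I. {y \<in> topspace Y. R i x y})" using cov x by blast
    then obtain i W where W: "i \<in> I" "openin Y W" "W \<noteq> {}" "W \<subseteq> {y \<in> topspace Y. R i x y}"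
      using Baire_space_countable_closed_cover[OF Y(1,2) c, of "\<lambda>i. {y \<in> topspace Y. R i x y}"]
        clY x by metis
    then obtain V where "V \<in> \<B>" "V \<noteq> {}" "V \<subseteq> W" using \<B>(3) by blast
    then have "(i, V) \<in> J" "x \<in> C (i, V)" using W x by (auto simp: J_def C_def)
    then show "x \<in> (\<Union>j\<in>J. C j)" by blast
  qed
  ultimately obtain j U where U: "j \<in> J" "openin X U" "U \<noteq> {}" "U \<subseteq> C j"
    using Baire_space_countable_closed_cover[OF X, of J C] by metis
  obtain i V where "j = (i, V)" "i \<in> I" "V \<in> \<B>" "V \<noteq> {}" using U(1) by (auto simp: J_def)
  then show ?thesis
    using that[of i U V] U \<B>(2) by (auto simp: C_def)
qed

text \<open>
  The open sets with image in a \<open>\<sigma>\<close>-ideal have a largest member: the union of the basic ones,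
  whose image is small because the base is countable. If a relatively open piece \<open>U \<inter> C\<close> of
  the complement had small image, so would \<open>U\<close>, and \<open>U\<close> would have been removed.
\<close>

lemma sigma_ideal_kernel:
  assumes X: "second_countable X" and I: "sigma_ideal \<I>"
  obtains C where "closedin X C" "f ` (topspace X - C) \<in> \<I>"
    "\<And>U. openin X U \<Longrightarrow> U \<inter> C \<noteq> {} \<Longrightarrow> f ` (U \<inter> C) \<notin> \<I>"
proof -
  have mono: "B \<in> \<I>" if "A \<in> \<I>" "B \<subseteq> A" for A B
    using I that by (simp add: sigma_ideal_def)
  have Un: "\<Union>\<A> \<in> \<I>" if "countable \<A>" "\<A> \<subseteq> \<I>" for \<A>
    using I that by (simp add: sigma_ideal_def)
  obtain \<B> where \<B>: "countable \<B>" "\<forall>V\<in>\<B>. openin X V"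
    "\<forall>U x. openin X U \<and> x \<in> U \<longrightarrow> (\<exists>V\<in>\<B>. x \<in> V \<and> V \<subseteq> U)"
    using X unfolding second_countable_def by (elim exE conjE)
  define S where "S = {V \<in> \<B>. f ` V \<in> \<I>}"
  have S: "openin X (\<Union>S)" using \<B>(2) by (intro openin_Union) (simp add: S_def)
  have "\<Union>((`) f ` S) \<in> \<I>"
    by (rule Un) (use \<B>(1) in \<open>auto simp: S_def\<close>)
  moreover have "\<Union>((`) f ` S) = f ` \<Union>S" by (rule image_Union[symmetric])
  ultimately have small: "f ` \<Union>S \<in> \<I>" by argo
  have diff: "topspace X - (topspace X - \<Union>S) = \<Union>S" using openin_subset[OF S] by blast
  show ?thesis
  proof (rule that[of "topspace X - \<Union>S"])
    show "closedin X (topspace X - \<Union>S)" using closedin_diff[OF closedin_topspace S] .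
    show "f ` (topspace X - (topspace X - \<Union>S)) \<in> \<I>" unfolding diff by (rule small)
  next
    fix U assume U: "openin X U" "U \<inter> (topspace X - \<Union>S) \<noteq> {}"
    show "f ` (U \<inter> (topspace X - \<Union>S)) \<notin> \<I>"
    proof
      assume "f ` (U \<inter> (topspace X - \<Union>S)) \<in> \<I>"
      then have "f ` (U \<inter> (topspace X - \<Union>S)) \<union> f ` \<Union>S \<in> \<I>"
        using Un[of "{f ` (U \<inter> (topspace X - \<Union>S)), f ` \<Union>S}"] small by simp
      moreover have "U \<subseteq> (U \<inter> (topspace X - \<Union>S)) \<union> \<Union>S"
        using openin_subset[OF U(1)] by auto
      then have "f ` U \<subseteq> f ` (U \<inter> (topspace X - \<Union>S)) \<union> f ` \<Union>S"
        unfolding image_Un[symmetric] by (rule image_mono)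
      ultimately have fU: "f ` U \<in> \<I>" by (rule mono)
      obtain x where x: "x \<in> U" "x \<notin> \<Union>S" using U by blast
      then obtain V where V: "V \<in> \<B>" "x \<in> V" "V \<subseteq> U" using \<B>(3) U(1) by meson
      have "f ` V \<in> \<I>" using V by (intro mono[OF fU]) blast
      then have "V \<in> S" using V(1) by (simp add: S_def)
      then show False using V(2) x(2) by blast
    qed
  qed
qed


section \<open>Steinhaus' theorem\<close>

lemma
  assumes "Haar_measure \<mu>"
  shows sets_Haar: "sets \<mu> = sets borel"
    and emeasure_Haar_translate: "B \<in> sets borel \<Longrightarrow> emeasure \<mu> ((+) a ` B) = emeasure \<mu> B"
    and emeasure_Haar_compact: "compact K \<Longrightarrow> emeasure \<mu> K < \<infinity>"
    and emeasure_Haar_outer: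
      "B \<in> sets borel \<Longrightarrow> emeasure \<mu> B < c \<Longrightarrow> \<exists>U. open U \<and> B \<subseteq> U \<and> emeasure \<mu> U < c"
proof -
  have sets: "sets \<mu> = sets borel"
    using assms unfolding Haar_measure_def by (elim conjE)
  have trans: "\<forall>a. \<forall>B\<in>sets borel. emeasure \<mu> ((+) a ` B) = emeasure \<mu> B"
    using assms unfolding Haar_measure_def by (elim conjE)
  have fin: "\<forall>K. compact K \<longrightarrow> emeasure \<mu> K < \<infinity>"
    using assms unfolding Haar_measure_def by (elim conjE)
  have outer: "\<forall>B\<in>sets borel. emeasure \<mu> B = (INF U\<in>{U. open U \<and> B \<subseteq> U}. emeasure \<mu> U)"
    using assms unfolding Haar_measure_def by (elim conjE)
  show "sets \<mu> = sets borel" by (rule sets)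
  show "emeasure \<mu> ((+) a ` B) = emeasure \<mu> B" if "B \<in> sets borel"
    using bspec[OF spec[OF trans] that] .
  show "emeasure \<mu> K < \<infinity>" if "compact K"
    using mp[OF spec[OF fin] that] .
  show "\<exists>U. open U \<and> B \<subseteq> U \<and> emeasure \<mu> U < c"
    if B: "B \<in> sets borel" and less: "emeasure \<mu> B < c"
  proof -
    have "(INF U\<in>{U. open U \<and> B \<subseteq> U}. emeasure \<mu> U) < c"
      using less unfolding bspec[OF outer B] .
    then show ?thesis unfolding INF_less_iff by blast
  qed
qed

text \<open>
  The tube lemma, in the form that turns a neighbourhood of a translate of a compact set into a
  neighbourhood of the translating element.
\<close>

lemma open_compact_forall:
  fixes g :: "'a::topological_space \<times> 'b::topological_space \<Rightarrow> 'c::topological_space"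
  assumes K: "compact K" and W: "open W" and g: "continuous_on UNIV g"
  shows "open {x. \<forall>y\<in>K. g (x, y) \<in> W}"
proof (subst open_subopen, intro ballI)
  fix x assume "x \<in> {x. \<forall>y\<in>K. g (x, y) \<in> W}"
  then have "{x} \<times> K \<subseteq> g -` W" by auto
  then obtain U where "x \<in> U" "open U" "U \<times> K \<subseteq> g -` W"
    using Elementary_Topology.tube_lemma[OF K open_vimage[OF W g]] by blast
  then show "\<exists>T. open T \<and> x \<in> T \<and> T \<subseteq> {x. \<forall>y\<in>K. g (x, y) \<in> W}" by blast
qed

lemma compact_image_add:
  fixes A B :: "'a::topological_monoid_add set"
  assumes "compact A" "compact B"
  shows "compact ((\<lambda>(a, b). a + b) ` (A \<times> B))"
  unfolding case_prod_beta
  by (intro compact_continuous_image compact_Times assms continuous_intros)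

lemma compact_imp_borel: "compact (K :: 'a::t2_space set) \<Longrightarrow> K \<in> sets borel"
  by (simp add: borel_closed compact_imp_closed)

lemma compact_translate:
  "compact B \<Longrightarrow> compact ((+) (a :: 'a::topological_monoid_add) ` B)"
  by (intro compact_continuous_image continuous_intros)

text \<open>
  If \<open>V\<close> is an open superset of \<open>C\<close> with measure less than twice that of \<open>C\<close>, then a translate
  of \<open>C\<close> that stays inside \<open>V\<close> leaves no room for being disjoint from \<open>C\<close>. Small translations
  do keep \<open>C\<close> inside \<open>V\<close>, as \<open>C\<close> is compact.
\<close>

lemma Steinhaus_translates_meet:
  fixes C :: "'a::{topological_group_add, t2_space} set"
  assumes \<mu>: "Haar_measure \<mu>" and C: "compact C" "emeasure \<mu> C \<noteq> 0"
  obtains U where "open U" "0 \<in> U" "\<And>v. v \<in> U \<Longrightarrow> \<exists>c\<in>C. v + c \<in> C"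
proof -
  have fin: "emeasure \<mu> C < \<infinity>" using emeasure_Haar_compact[OF \<mu> C(1)] .
  then have "emeasure \<mu> C < emeasure \<mu> C + emeasure \<mu> C"
    using C(2) by (metis add.right_neutral ennreal_add_left_cancel_less infinity_ennreal_def
        less_irrefl zero_less_iff_neq_zero)
  then obtain V where V: "open V" "C \<subseteq> V" "emeasure \<mu> V < emeasure \<mu> C + emeasure \<mu> C"
    using emeasure_Haar_outer[OF \<mu> compact_imp_borel[OF C(1)]] by blast
  show ?thesis
  proof (rule that[of "{v. \<forall>c\<in>C. v + c \<in> V}"])
    show "open {v. \<forall>c\<in>C. v + c \<in> V}"
      using open_compact_forall[OF C(1) V(1), of "\<lambda>(v, c). v + c"]
      by (simp add: case_prod_beta continuous_intros)
    show "0 \<in> {v. \<forall>c\<in>C. v + c \<in> V}" using V(2) by auto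
  next
    fix v assume v: "v \<in> {v. \<forall>c\<in>C. v + c \<in> V}"
    show "\<exists>c\<in>C. v + c \<in> C"
    proof (rule ccontr)
      assume "\<not> ?thesis"
      then have disj: "C \<inter> (+) v ` C = {}" by auto
      have meas: "C \<in> sets \<mu>" "(+) v ` C \<in> sets \<mu>" "V \<in> sets \<mu>"
        using compact_imp_borel[OF C(1)] compact_imp_borel[OF compact_translate[OF C(1)]] V(1)
        by (simp_all add: sets_Haar[OF \<mu>])
      have "emeasure \<mu> C + emeasure \<mu> C = emeasure \<mu> C + emeasure \<mu> ((+) v ` C)"
        using emeasure_Haar_translate[OF \<mu> compact_imp_borel[OF C(1)]] by simp
      also have "\<dots> = emeasure \<mu> (C \<union> (+) v ` C)"
        using plus_emeasure[OF meas(1,2) disj] .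
      also have "\<dots> \<le> emeasure \<mu> V"
        using v V(2) meas by (intro emeasure_mono) auto
      finally show False using V(3) by simp
    qed
  qed
qed

text \<open>
  Formally, Fubini's theorem and left invariance yield
  \<open>\<integral> \<mu> (A \<inter> (w - B)) dw = \<integral>\<^sub>A \<mu> (x + B) dx = \<mu> A * \<mu> B\<close>, where the first integrand
  vanishes outside the compact set \<open>D = A + B\<close>. The discrete version: if every overlap were
  null, each \<open>w - B\<close> would have an open superset \<open>Q w\<close> that meets \<open>A\<close> in measure at most
  \<open>\<epsilon>\<close>. Partition \<open>D\<close> into finitely many Borel sets \<open>E i\<close> such that \<open>u - B \<subseteq> Q (w i)\<close> for all
  \<open>u\<close> in \<open>E i\<close>. For \<open>x\<close> in \<open>A\<close>, the pieces that meet \<open>x + B\<close> cover it and have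
  \<open>x \<in> Q (w i)\<close>, so \<open>\<mu> B\<close> is at most the sum of the \<open>\<mu> (E i)\<close> with \<open>x \<in> Q (w i)\<close>.
  Integration over \<open>A\<close> gives \<open>\<mu> A * \<mu> B \<le> \<epsilon> * \<mu> D\<close>, which fails for small \<open>\<epsilon>\<close>. Only left
  translates of \<open>B\<close> are measured, as the left invariance of \<open>\<mu>\<close> requires.
\<close>

lemma exists_positive_overlap:
  fixes A B :: "'a::{topological_group_add, t2_space} set"
  assumes \<mu>: "Haar_measure \<mu>"
    and A: "compact A" "emeasure \<mu> A \<noteq> 0" and B: "compact B" "emeasure \<mu> B \<noteq> 0"
  obtains w where "emeasure \<mu> (A \<inter> (\<lambda>b. w - b) ` B) \<noteq> 0"
proof (rule ccontr)
  assume *: "\<not> thesis"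
  define D where "D = (\<lambda>(a, b). a + b) ` (A \<times> B)"
  have D: "compact D" using compact_image_add A B by (simp add: D_def)
  note finA = emeasure_Haar_compact[OF \<mu> A(1)] and finB = emeasure_Haar_compact[OF \<mu> B(1)]
    and finD = emeasure_Haar_compact[OF \<mu> D]
  obtain \<epsilon> where \<epsilon>: "\<epsilon> > 0" "\<epsilon> * emeasure \<mu> D < emeasure \<mu> A * emeasure \<mu> B"
  proof -
    obtain p q r where pqr: "emeasure \<mu> A = ennreal p" "emeasure \<mu> B = ennreal q"
      "emeasure \<mu> D = ennreal r" "0 \<le> p" "0 \<le> q" "0 \<le> r"
      using finA finB finD by (metis ennreal_cases infinity_ennreal_def less_irrefl)
    then have pq: "0 < p" "0 < q" using A B by (auto simp: less_le)
    \<comment> \<open>the summand 1 keeps the denominator positive, since \<open>r \<ge> 0\<close>\<close>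
    have "p * q / (r + 1) * r < p * q"
      using pq pqr by (simp add: field_simps add_pos_pos)
    then show ?thesis
      using that[of "ennreal (p * q / (r + 1))"] pq pqr
      by (simp add: ennreal_mult[symmetric] ennreal_lessI)
  qed
  have "\<exists>Q. open Q \<and> (\<forall>b\<in>B. w - b \<in> Q) \<and> emeasure \<mu> (A \<inter> Q) \<le> \<epsilon>" for w
  proof -
    have "compact ((\<lambda>b. w - b) ` B)"
      by (intro compact_continuous_image continuous_intros B)
    then have cpt: "compact (A \<inter> (\<lambda>b. w - b) ` B)" using A compact_Int by blast
    have "emeasure \<mu> (A \<inter> (\<lambda>b. w - b) ` B) < \<epsilon>" using * that \<epsilon>(1) by metis
    then obtain V where V: "open V" "A \<inter> (\<lambda>b. w - b) ` B \<subseteq> V" "emeasure \<mu> V < \<epsilon>"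
      using emeasure_Haar_outer[OF \<mu> compact_imp_borel[OF cpt]] by blast
    \<comment> \<open>\<open>V\<close> is known to contain only the part of \<open>w - B\<close> inside \<open>A\<close>; adding the open set \<open>- A\<close> captures
      the rest without enlarging the overlap with \<open>A\<close>\<close>
    have "emeasure \<mu> (A \<inter> (V \<union> - A)) \<le> emeasure \<mu> V"
      using V(1) by (intro emeasure_mono) (auto simp: sets_Haar[OF \<mu>])
    then show ?thesis
      using V compact_imp_closed[OF A(1)] by (intro exI[of _ "V \<union> - A"]) (auto simp: open_Compl)
  qed
  then obtain Q where Q: "\<And>w. open (Q w)" "\<And>w b. b \<in> B \<Longrightarrow> w - b \<in> Q w"
    "\<And>w. emeasure \<mu> (A \<inter> Q w) \<le> \<epsilon>"
    by metis
  define N where "N w = {u. \<forall>b\<in>B. u - b \<in> Q w}" for w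
  have N: "open (N w)" "w \<in> N w" for w
    using open_compact_forall[OF B(1) Q(1), of "\<lambda>(u, b). u - b" w] Q(2)
    by (simp_all add: case_prod_beta continuous_intros N_def)
  have "D \<subseteq> (\<Union>w\<in>D. N w)" using N(2) by blast
  then obtain F where F: "F \<subseteq> D" "finite F" "D \<subseteq> (\<Union>w\<in>F. N w)"
    using compactE_image[OF D, of D N] N(1) by metis
  obtain w and n :: nat where w: "F = w ` {0..<n}"
    using F(2) by (metis atLeast0LessThan finite_imp_nat_seg_image_inj_on lessThan_def)
  define E where "E i = D \<inter> disjointed (\<lambda>i. N (w i)) i" for i
  have Dmeas: "D \<in> sets borel" using compact_imp_borel[OF D] .
  have Emeas: "E i \<in> sets \<mu>" for i
    unfolding E_def disjointed_def sets_Haar[OF \<mu>]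
    using Dmeas N(1) by (intro sets.Int sets.Diff sets.finite_UN) auto
  have Edisj: "disjoint_family_on E {0..<n}"
    using disjoint_family_disjointed[of "\<lambda>i. N (w i)"]
    unfolding disjoint_family_on_def E_def by blast
  have EN: "E i \<subseteq> N (w i)" for i
    using disjointed_subset[of "\<lambda>i. N (w i)"] by (auto simp: E_def)
  have ED: "(\<Union>i\<in>{0..<n}. E i) = D"
    using finite_UN_disjointed_eq[of "\<lambda>i. N (w i)" n] F(3) unfolding w E_def by auto
  have AQ: "A \<inter> Q (w i) \<in> sets \<mu>" for i
    using compact_imp_borel[OF A(1)] Q(1) by (auto simp: sets_Haar[OF \<mu>])
  have key: "emeasure \<mu> B * indicator A x \<le>
      (\<Sum>i\<in>{0..<n}. emeasure \<mu> (E i) * indicator (A \<inter> Q (w i)) x)" for x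
  proof (cases "x \<in> A")
    case True
    let ?J = "{i \<in> {0..<n}. x \<in> Q (w i)}"
    have "(+) x ` B \<subseteq> (\<Union>i\<in>?J. E i)"
    proof
      fix u assume "u \<in> (+) x ` B"
      then obtain b where b: "b \<in> B" "u = x + b" by blast
      then have "u \<in> D" using True by (auto simp: D_def)
      then obtain i where i: "i < n" "u \<in> E i" using ED by auto
      then have "u - b \<in> Q (w i)" using EN[of i] b(1) unfolding N_def by blast
      then show "u \<in> (\<Union>i\<in>?J. E i)" using b i by auto
    qed
    then have "emeasure \<mu> ((+) x ` B) \<le> emeasure \<mu> (\<Union>i\<in>?J. E i)"
      using Emeas by (intro emeasure_mono) auto
    also have "\<dots> \<le> (\<Sum>i\<in>?J. emeasure \<mu> (E i))"
      using Emeas by (intro emeasure_subadditive_finite) auto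
    also have "\<dots> = (\<Sum>i\<in>{0..<n}. emeasure \<mu> (E i) * indicator (A \<inter> Q (w i)) x)"
      using True by (intro sum.mono_neutral_cong_left) auto
    finally show ?thesis
      using True emeasure_Haar_translate[OF \<mu> compact_imp_borel[OF B(1)]] by simp
  qed simp
  have "emeasure \<mu> A * emeasure \<mu> B = (\<integral>\<^sup>+x. emeasure \<mu> B * indicator A x \<partial>\<mu>)"
    using compact_imp_borel[OF A(1)] sets_Haar[OF \<mu>]
    by (subst nn_integral_cmult_indicator) (auto simp: mult.commute)
  also have "\<dots> \<le> (\<integral>\<^sup>+x. (\<Sum>i\<in>{0..<n}. emeasure \<mu> (E i) * indicator (A \<inter> Q (w i)) x) \<partial>\<mu>)"
    by (intro nn_integral_mono key)
  also have "\<dots> = (\<Sum>i\<in>{0..<n}. emeasure \<mu> (E i) * emeasure \<mu> (A \<inter> Q (w i)))"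
    using AQ by (subst nn_integral_sum) (auto simp: nn_integral_cmult_indicator)
  also have "\<dots> \<le> (\<Sum>i\<in>{0..<n}. emeasure \<mu> (E i) * \<epsilon>)"
    by (intro sum_mono mult_left_mono Q(3)) auto
  also have "\<dots> = \<epsilon> * (\<Sum>i\<in>{0..<n}. emeasure \<mu> (E i))"
    by (simp add: sum_distrib_left mult.commute)
  also have "(\<Sum>i\<in>{0..<n}. emeasure \<mu> (E i)) = emeasure \<mu> D"
    using sum_emeasure[of E "{0..<n}" \<mu>] Emeas Edisj ED by auto
  finally show False using \<epsilon>(2) by simp
qed

text \<open>
  On the overlap \<open>C\<close> of \<open>A\<close> with \<open>w - B\<close>, a small translation \<open>v\<close> still sends some
  \<open>c = w - b\<close> to a point of \<open>A\<close>, and then \<open>v + w = (v + c) + b\<close> is in \<open>A + B\<close>. Hence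
  \<open>A + B\<close> contains a neighbourhood of \<open>w\<close>.
\<close>

lemma Steinhaus_sum:
  fixes A B :: "'a::{topological_group_add, t2_space} set"
  assumes \<mu>: "Haar_measure \<mu>"
    and A: "compact A" "emeasure \<mu> A \<noteq> 0" and B: "compact B" "emeasure \<mu> B \<noteq> 0"
  shows "interior ((\<lambda>(a, b). a + b) ` (A \<times> B)) \<noteq> {}"
proof -
  obtain w where w: "emeasure \<mu> (A \<inter> (\<lambda>b. w - b) ` B) \<noteq> 0"
    using exists_positive_overlap[OF assms] .
  let ?C = "A \<inter> (\<lambda>b. w - b) ` B"
  have "compact ((\<lambda>b. w - b) ` B)"
    by (intro compact_continuous_image continuous_intros B)
  then have "compact ?C" using A compact_Int by blast
  then obtain U where U: "open U" "0 \<in> U" "\<And>v. v \<in> U \<Longrightarrow> \<exists>c\<in>?C. v + c \<in> ?C"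
    using Steinhaus_translates_meet[OF \<mu> _ w] by blast
  have "open ((\<lambda>u. u - w) -` U)"
    by (intro open_vimage U continuous_intros)
  moreover have "w \<in> (\<lambda>u. u - w) -` U" using U by simp
  moreover have "(\<lambda>u. u - w) -` U \<subseteq> (\<lambda>(a, b). a + b) ` (A \<times> B)"
  proof
    fix u assume "u \<in> (\<lambda>u. u - w) -` U"
    then obtain c where c: "c \<in> ?C" "u - w + c \<in> ?C" using U(3) by blast
    then obtain b where b: "b \<in> B" "c = w - b" by blast
    have "u = (u - w + c) + b" unfolding b by (simp add: algebra_simps)
    then show "u \<in> (\<lambda>(a, b). a + b) ` (A \<times> B)" using c b by force
  qed
  ultimately show ?thesis using interior_maximal by blast
qed


section \<open>Meager semigroups\<close>

lemma closure_add_subset: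
  fixes A B N :: "'a::topological_monoid_add set"
  assumes N: "closed N" and AB: "\<And>a b. a \<in> A \<Longrightarrow> b \<in> B \<Longrightarrow> a + b \<in> N"
    and a: "a \<in> closure A" and b: "b \<in> closure B"
  shows "a + b \<in> N"
proof -
  have "closed ((\<lambda>(a, b). a + b) -` N)"
    unfolding case_prod_beta by (intro closed_vimage N continuous_intros)
  moreover have "A \<times> B \<subseteq> (\<lambda>(a, b). a + b) -` N" using AB by auto
  ultimately have "closure (A \<times> B) \<subseteq> (\<lambda>(a, b). a + b) -` N" by (simp add: closure_minimal)
  then show ?thesis using a b by (auto simp: closure_Times)
qed

lemma closed_null_ideal_if_covered:
  "closed F \<Longrightarrow> emeasure \<mu> F = 0 \<Longrightarrow> A \<subseteq> F \<Longrightarrow> A \<in> closed_null_ideal \<mu>"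
  unfolding closed_null_ideal_def by (intro CollectI exI[of _ "{F}"]) auto

lemma closed_null_ideal_sequence:
  assumes "A \<in> closed_null_ideal \<mu>"
  obtains F :: "nat \<Rightarrow> 'a::topological_space set"
  where "\<And>n. closed (F n)" "\<And>n. emeasure \<mu> (F n) = 0" "A \<subseteq> (\<Union>n. F n)"
proof -
  obtain \<F> where \<F>: "countable \<F>" "\<forall>F\<in>\<F>. closed F \<and> emeasure \<mu> F = 0" "A \<subseteq> \<Union>\<F>"
    using assms unfolding closed_null_ideal_def by blast
  \<comment> \<open>the empty set makes the family nonempty, so that it can be enumerated\<close>
  have "range (from_nat_into (insert {} \<F>)) = insert {} \<F>"
    using \<F>(1) by (intro range_from_nat_into) auto
  moreover from this have "closed (from_nat_into (insert {} \<F>) n)"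
    "emeasure \<mu> (from_nat_into (insert {} \<F>) n) = 0" for n
    using \<F>(2) by (metis closed_empty emeasure_empty insertE rangeI)+
  ultimately show ?thesis
    using that[of "from_nat_into (insert {} \<F>)"] \<F>(3) by auto
qed

text \<open>
  Here the category argument meets the measure argument: \<open>Y\<close> is the kernel of the
  parametrization with respect to the ideal, and \<open>H\<close> being closed under addition is what makes
  the nowhere dense sets cover all the sums \<open>f x + f y\<close>.
\<close>

lemma meager_semigroup_in_closed_null_ideal:
  fixes H :: "'a::{topological_group_add, t2_space} set"
  assumes lc: "locally_compact_space (euclidean :: 'a topology)"
    and \<mu>: "Haar_measure \<mu>"
    and H: "\<And>x y. x \<in> H \<Longrightarrow> y \<in> H \<Longrightarrow> x + y \<in> H"
    and meager: "meager_in euclidean H"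
    and qa: "quasi_analytic_space (subtopology euclidean H)"
  shows "H \<in> closed_null_ideal \<mu>"
proof (rule ccontr)
  assume notin: "H \<notin> closed_null_ideal \<mu>"
  obtain X :: "nat set topology" and f where hB: "hereditarily_Baire_space X"
    and X: "metrizable_space X" "separable_space X"
    and f: "continuous_map X (subtopology euclidean H) f" and fX: "f ` topspace X = H"
    using qa unfolding quasi_analytic_space_def by auto
  have sc: "second_countable X" using separable_metrizable_imp_second_countable X .
  obtain C where C: "closedin X C" "f ` (topspace X - C) \<in> closed_null_ideal \<mu>"
    and big: "\<And>U. openin X U \<Longrightarrow> U \<inter> C \<noteq> {} \<Longrightarrow> f ` (U \<inter> C) \<notin> closed_null_ideal \<mu>"
    using sigma_ideal_kernel[OF sc sigma_ideal_closed_null_ideal] by metis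
  have "C \<noteq> {}" using C(2) notin fX by auto
  define Y where "Y = subtopology X C"
  have topY: "topspace Y = C" using closedin_subset[OF C(1)] by (auto simp: Y_def)
  have Y: "Baire_space Y" "topspace Y \<noteq> {}" "second_countable Y"
    using hB C(1) \<open>C \<noteq> {}\<close> topY second_countable_subtopology[OF sc]
    by (auto simp: Y_def hereditarily_Baire_space_def)
  have fY: "continuous_map Y euclidean f"
    using f by (simp add: Y_def continuous_map_from_subtopology continuous_map_in_subtopology)
  have fH: "f x \<in> H" if "x \<in> C" for x using that closedin_subset[OF C(1)] fX by blast
  have bigY: "f ` U \<notin> closed_null_ideal \<mu>" if "openin Y U" "U \<noteq> {}" for U
    using that big by (auto simp: Y_def openin_subtopology)
  obtain \<N> where \<N>: "countable \<N>" "\<And>N. N \<in> \<N> \<Longrightarrow> interior (closure N) = {}" "H = \<Union>\<N>"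
    using meager unfolding meager_in_def nowhere_dense_in_def by auto
  have pre: "closedin Y {x \<in> topspace Y. g (f x) \<in> closure N}"
    if "continuous_on UNIV g" for g :: "'a \<Rightarrow> 'a" and N
  proof -
    have "closed (g -` closure N)" using that by (simp add: closed_vimage)
    then show ?thesis using closedin_continuous_map_preimage[OF fY] by fastforce
  qed
  obtain N U V where N: "N \<in> \<N>" and U: "openin Y U" "U \<noteq> {}" and V: "openin Y V" "V \<noteq> {}"
    and UV: "\<And>x y. x \<in> U \<Longrightarrow> y \<in> V \<Longrightarrow> f x + f y \<in> closure N"
  proof (rule Baire_space_rectangle[OF Y(1,2) Y \<N>(1), of "\<lambda>N x y. f x + f y \<in> closure N"])
    show "closedin Y {y \<in> topspace Y. f x + f y \<in> closure N}" for x N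
      by (rule pre) (intro continuous_intros)
    show "closedin Y {x \<in> topspace Y. f x + f y \<in> closure N}" for y N
      by (rule pre) (intro continuous_intros)
    show "\<exists>N\<in>\<N>. f x + f y \<in> closure N" if "x \<in> topspace Y" "y \<in> topspace Y" for x y
    proof -
      have "f x + f y \<in> H" using that topY fH H by blast
      then show ?thesis using \<N>(3) closure_subset by blast
    qed
  qed blast
  \<comment> \<open>Non-null alone is too weak: an outer regular Haar measure can be infinite on a closed set
    all of whose compact subsets are null. Shrinking the open set makes the closure itself
    compact, and the shrunken image is still outside the ideal.\<close>
  have compact_part: "\<exists>A. A \<subseteq> f ` U \<and> compact (closure A) \<and> emeasure \<mu> (closure A) \<noteq> 0"
    if U: "openin Y U" "U \<noteq> {}" for U
  proof -
    obtain u where u: "u \<in> U" using U by blast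
    obtain W K where W: "open W" "compact K" "f u \<in> W" "W \<subseteq> K"
      using lc unfolding locally_compact_space_def by simp meson
    have "openin Y {x \<in> topspace Y. f x \<in> W}"
      using openin_continuous_map_preimage[OF fY] W(1) by simp
    then have "openin Y (U \<inter> {x \<in> topspace Y. f x \<in> W})" using U by blast
    moreover have "u \<in> U \<inter> {x \<in> topspace Y. f x \<in> W}" using u W U openin_subset by blast
    ultimately have "f ` (U \<inter> {x \<in> topspace Y. f x \<in> W}) \<notin> closed_null_ideal \<mu>"
      using bigY by blast
    moreover have "closure (f ` (U \<inter> {x \<in> topspace Y. f x \<in> W})) \<subseteq> K"
      using W compact_imp_closed by (intro closure_minimal) auto
    ultimately show ?thesis
      using closed_null_ideal_if_covered[OF closed_closure _ closure_subset]
        compact_Int_closed[OF W(2) closed_closure, of "f ` (U \<inter> {x \<in> topspace Y. f x \<in> W})"]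
      by (intro exI[of _ "f ` (U \<inter> {x \<in> topspace Y. f x \<in> W})"])
        (auto simp del: image_Int simp: inf.absorb2)
  qed
  obtain A where A: "A \<subseteq> f ` U" "compact (closure A)" "emeasure \<mu> (closure A) \<noteq> 0"
    using compact_part[OF U] by blast
  obtain B where B: "B \<subseteq> f ` V" "compact (closure B)" "emeasure \<mu> (closure B) \<noteq> 0"
    using compact_part[OF V] by blast
  have "(\<lambda>(a, b). a + b) ` (closure A \<times> closure B) \<subseteq> closure N"
    using closure_add_subset[OF closed_closure, of A B N] UV A(1) B(1) by fastforce
  then have "interior (closure N) \<noteq> {}"
    using Steinhaus_sum[OF \<mu> A(2,3) B(2,3)] interior_mono by blast
  then show False using \<N>(2) N by blast
qed

theorem theorem5p1:
  fixes H :: "'a::{topological_group_add, t2_space} set"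
    and \<mu> :: "'a measure"
  assumes "locally_compact_space (euclidean :: 'a topology)"
    and "Haar_measure \<mu>"
    and "\<And>x y. x \<in> H \<Longrightarrow> y \<in> H \<Longrightarrow> x + y \<in> H"
    and "meager_in euclidean H"
    and "quasi_analytic_space (subtopology euclidean H)"
  shows "H \<in> closed_null_ideal \<mu> \<and>
         (\<exists>F :: nat \<Rightarrow> 'a set.
            (\<forall>n. closed (F n) \<and> emeasure \<mu> (F n) = 0) \<and> H \<subseteq> (\<Union>n. F n))"
proof
  show H: "H \<in> closed_null_ideal \<mu>"
    using meager_semigroup_in_closed_null_ideal[OF assms] .
  show "\<exists>F :: nat \<Rightarrow> 'a set.
      (\<forall>n. closed (F n) \<and> emeasure \<mu> (F n) = 0) \<and> H \<subseteq> (\<Union>n. F n)"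
    using closed_null_ideal_sequence[OF H] by metis
qed

end
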